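(* Let $\mathcal{A}=\{L_0,L_1,\dots,L_n\}$ be a line arrangement in $\mathbb{P}^2$ in the class $\mathcal{C}_3$, with complement $M$, such that all the points of multiplicity at least 3 lie on $L_0\cup L_1\cup L_2$ and the three lines $L_0,L_1,L_2$ are concurrent; let $O=L_0\cap L_1\cap L_2$. Let $\mathcal{L}\in\mathbb{T}(M)$ be a rank one local system, let $a_0,\dots,a_n$ be the residues with $\mathrm{Re}(a_j)\in[0,1)$ for all $j\ge 1$ associated to $\mathcal{L}$, and let $P_1$, $P_2$ be the corresponding sets of extremal points for $\mathcal{L}$ on $L_1$ and $L_2$. For a point $q\in L_0$ let $Y_q$ be the union of the lines of $\mathcal{A}$ passing through $q$. Assume that one of the following conditions holds: (i) $P_1=\emptyset$; (ii) $P_2=\emptyset$; (iii) for each point $q\in L_0$, $q\neq O$, of multiplicity at least 3, one has either (a) $P_1\setminus Y_q$ and $P_2\setminus Y_q$ are both non-empty, or (b) for some $(i,j)\in\{(1,2),(2,1)\}$ there are a point $p_i\in P_i\setminus Y_q$ and an extremal point $p_j\in P_j$ such that the line determined by $p_i$ and $p_j$ is not in $\mathcal{A}$. Then the local system $\mathcal{L}$ is admissible.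
   Context: A line arrangement is a finite nonempty set $\mathcal{A}=\{L_0,\dots,L_n\}$ of distinct lines in the complex projective plane $\mathbb{P}^2$; its complement is $M=\mathbb{P}^2\setminus(L_0\cup\dots\cup L_n)$. The multiplicity of a point is the number of lines of $\mathcal{A}$ passing through it. The arrangement is of type (in the class) $\mathcal{C}_k$ if $k\ge 0$ is the minimal number of lines in $\mathcal{A}$ whose union contains all the points of multiplicity at least 3. $\mathbb{T}(M)=\mathrm{Hom}(\pi_1(M),\mathbb{C}^* )$ is identified with the set of rank one complex local systems on $M$. A rank one local system $\mathcal{L}\in\mathbb{T}(M)$ is the same as a choice of monodromies $\lambda_j\in\mathbb{C}^*$ around $L_j$, $0\le j\le n$, with $\lambda_0\cdots\lambda_n=1$. A class $\alpha\in H^1(M,\mathbb{C})$ is given by $\alpha=\sum_{j=0}^n a_j\,\frac{df_j}{f_j}$, where $f_j=0$ is a linear equation of $L_j$ and the residues $a_j\in\mathbb{C}$ satisfy $\sum_{j=0}^n a_j=0$. The map $\exp:H^1(M,\mathbb{C})\to\mathbb{T}(M)$ is induced by $t\mapsto\exp(2\pi i t)$, so that $\exp(\alpha)=\mathcal{L}$ if and only if $\lambda_j=\exp(2\pi i a_j)$ for all $j=0,\dots,n$. The local system $\mathcal{L}$ is admissible if there is a class $\alpha=\sum_{j=0}^n a_j\,\frac{df_j}{f_j}\in H^1(M,\mathbb{C})$, with residues $a_j\in\mathbb{C}$ satisfying $\sum_{j=0}^n a_j=0$, such that $\exp(\alpha)=\mathcal{L}$, $a_j\notin\mathbb{Z}_{>0}$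 for all $j=0,\dots,n$, and for any point $p\in L_0\cup\dots\cup L_n$ of multiplicity at least 3 one has $a(p)=\sum_{j:\,p\in L_j}a_j\notin\mathbb{Z}_{>0}$. Residues and extremal points used in the claim: given $\mathcal{L}$ with monodromies $\lambda_j$, take the (unique) residues $a_j$ with $\exp(2\pi i a_j)=\lambda_j$ and $\mathrm{Re}(a_j)\in[0,1)$ for all $j\ge 1$, and $a_0=-\sum_{j=1}^n a_j$. For a point $p$ set $b(p)=\mathrm{Re}\big(\sum_{j:\,p\in L_j}a_j\big)$. For $j=1,2$ let $m_j$ be the maximum of the numbers $b(p)$ over all points $p\neq O$ of multiplicity at least 3 on $L_j$ such that $b(p)\in\mathbb{Z}_{>0}$, with the convention $\max\emptyset=0$. The set $P_j$ of extremal points for $\mathcal{L}$ on $L_j$ is the set of points $p\ne O$ of multiplicity at least 3 on $L_j$ with $b(p)=m_j$ if $m_j>0$, and $P_j=\emptyset$ if $m_j=0$. *)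

theory Defs
  imports "HOL-Analysis.Analysis"
begin

text \<open>The complex projective plane: points are the complex lines through the origin of
  \<open>\<complex>\<^sup>3\<close>. The span is taken in the complex vector space (\<open>vec.span\<close>, with respect to
  \<open>*s\<close>), not in the underlying real one.\<close>

typedef cp2 = "{vec.span {v} | v :: complex^3. v \<noteq> 0}"
proof -
  have "axis 1 1 \<noteq> (0 :: complex^3)"
    by (simp add: axis_eq_0_iff)
  then show ?thesis by blast
qed

text \<open>The zero locus of the linear form with coefficient vector \<open>f\<close>. The pairing is bilinear;
  \<open>\<bullet>\<close> on \<open>complex^3\<close> would be the real inner product.\<close>

definition zero_locus :: "complex^3 \<Rightarrow> cp2 set" where
  "zero_locus f = {p. \<forall>v \<in> Rep_cp2 p. (\<Sum>i\<in>UNIV. f $ i * v $ i) = 0}"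

definition is_line :: "cp2 set \<Rightarrow> bool" where
  "is_line l \<longleftrightarrow> (\<exists>f. f \<noteq> 0 \<and> l = zero_locus f)"

text \<open>Meaningful only for \<open>p \<noteq> q\<close>.\<close>

definition line_through :: "cp2 \<Rightarrow> cp2 \<Rightarrow> cp2 set" where
  "line_through p q = (THE l. is_line l \<and> p \<in> l \<and> q \<in> l)"

text \<open>An arrangement \<open>{L\<^sub>0, \<dots>, L\<^sub>n}\<close> is given by \<open>n\<close> and the family \<open>L\<close>, of which only the
  values at indices \<open>j \<le> n\<close> matter; the same applies to monodromies and residues below.\<close>

definition line_arrangement :: "nat \<Rightarrow> (nat \<Rightarrow> cp2 set) \<Rightarrow> bool" where
  "line_arrangement n L \<longleftrightarrow> (\<forall>j\<le>n. is_line (L j)) \<and> inj_on L {..n}"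

definition multiplicity_at :: "cp2 set set \<Rightarrow> cp2 \<Rightarrow> nat" where
  "multiplicity_at A p = card {l \<in> A. p \<in> l}"

definition multiple_points :: "cp2 set set \<Rightarrow> cp2 set" where
  "multiple_points A = {p. multiplicity_at A p \<ge> 3}"

definition in_class_C :: "nat \<Rightarrow> cp2 set set \<Rightarrow> bool" where
  "in_class_C k A \<longleftrightarrow>
     (\<exists>B\<subseteq>A. card B = k \<and> multiple_points A \<subseteq> \<Union>B) \<and>
     (\<forall>B\<subseteq>A. multiple_points A \<subseteq> \<Union>B \<longrightarrow> k \<le> card B)"

definition lines_through_union :: "cp2 set set \<Rightarrow> cp2 \<Rightarrow> cp2 set" where
  "lines_through_union A q = \<Union>{l \<in> A. q \<in> l}"

text \<open>An element of \<open>T(M) = Hom(\<pi>\<^sub>1(M), \<complex>\<^sup>*)\<close> is represented by its monodromies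
  \<open>\<lambda>\<^sub>j \<in> \<complex>\<^sup>*\<close> around the lines \<open>L\<^sub>j\<close>, subject to \<open>\<lambda>\<^sub>0 \<cdots> \<lambda>\<^sub>n = 1\<close>; a class
  \<open>\<alpha> = \<Sum>\<^sub>j a\<^sub>j df\<^sub>j / f\<^sub>j\<close> in \<open>H\<^sup>1(M, \<complex>)\<close> by its residues \<open>a\<^sub>j\<close>, subject to \<open>\<Sum>\<^sub>j a\<^sub>j = 0\<close>.\<close>

definition rank_one_local_system :: "nat \<Rightarrow> (nat \<Rightarrow> complex) \<Rightarrow> bool" where
  "rank_one_local_system n lam \<longleftrightarrow> (\<forall>j\<le>n. lam j \<noteq> 0) \<and> (\<Prod>j\<le>n. lam j) = 1"

definition H1_class :: "nat \<Rightarrow> (nat \<Rightarrow> complex) \<Rightarrow> bool" where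
  "H1_class n a \<longleftrightarrow> (\<Sum>j\<le>n. a j) = 0"

definition exp_class :: "(nat \<Rightarrow> complex) \<Rightarrow> nat \<Rightarrow> complex" where
  "exp_class a j = exp (2 * of_real pi * \<i> * a j)"

definition residue_at :: "nat \<Rightarrow> (nat \<Rightarrow> cp2 set) \<Rightarrow> (nat \<Rightarrow> complex) \<Rightarrow> cp2 \<Rightarrow> complex" where
  "residue_at n L a p = (\<Sum>j | j \<le> n \<and> p \<in> L j. a j)"

definition pos_ints :: "'a::ring_1 set" where
  "pos_ints = of_int ` {0<..}"

definition admissible :: "nat \<Rightarrow> (nat \<Rightarrow> cp2 set) \<Rightarrow> (nat \<Rightarrow> complex) \<Rightarrow> bool" where
  "admissible n L lam \<longleftrightarrow>
     (\<exists>a. H1_class n a \<and> (\<forall>j\<le>n. exp_class a j = lam j) \<and>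
          (\<forall>j\<le>n. a j \<notin> pos_ints) \<and>
          (\<forall>p \<in> (\<Union>j\<le>n. L j). multiplicity_at (L ` {..n}) p \<ge> 3 \<longrightarrow>
              residue_at n L a p \<notin> pos_ints))"

text \<open>The residues with real parts in \<open>[0,1)\<close> for \<open>j \<ge> 1\<close>; they exist and are unique on
  \<open>{0..n}\<close> for every local system.\<close>

definition normalized_residues :: "nat \<Rightarrow> (nat \<Rightarrow> complex) \<Rightarrow> (nat \<Rightarrow> complex) \<Rightarrow> bool" where
  "normalized_residues n lam a \<longleftrightarrow>
     (\<forall>j\<in>{1..n}. exp_class a j = lam j \<and> 0 \<le> Re (a j) \<and> Re (a j) < 1) \<and>
     a 0 = - (\<Sum>j=1..n. a j)"

definition b_value :: "nat \<Rightarrow> (nat \<Rightarrow> cp2 set) \<Rightarrow> (nat \<Rightarrow> complex) \<Rightarrow> cp2 \<Rightarrow> real" where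
  "b_value n L a p = Re (residue_at n L a p)"

definition max_b ::
  "nat \<Rightarrow> (nat \<Rightarrow> cp2 set) \<Rightarrow> (nat \<Rightarrow> complex) \<Rightarrow> cp2 \<Rightarrow> nat \<Rightarrow> real" where
  "max_b n L a pO j =
     (let S = b_value n L a ` {p \<in> multiple_points (L ` {..n}) \<inter> L j.
                                p \<noteq> pO \<and> b_value n L a p \<in> pos_ints}
      in if S = {} then 0 else Max S)"

definition extremal_points ::
  "nat \<Rightarrow> (nat \<Rightarrow> cp2 set) \<Rightarrow> (nat \<Rightarrow> complex) \<Rightarrow> cp2 \<Rightarrow> nat \<Rightarrow> cp2 set" where
  "extremal_points n L a pO j =
     (if max_b n L a pO j > 0
      then {p \<in> multiple_points (L ` {..n}) \<inter> L j.
              p \<noteq> pO \<and> b_value n L a p = max_b n L a pO j}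
      else {})"

end

theory Submission
  imports Defs
begin

text \<open>The residues \<open>a\<^sub>1\<close>, \<open>a\<^sub>2\<close>, \<open>a\<^sub>0\<close> are shifted by \<open>-m\<^sub>1\<close>, \<open>-m\<^sub>2\<close>, \<open>m\<^sub>1 + m\<^sub>2\<close>.
  By maximality of \<open>m\<^sub>j\<close> this removes the positive integers at the points of \<open>L\<^sub>1\<close> and \<open>L\<^sub>2\<close> other
  than \<open>O\<close>, and it changes nothing at \<open>O\<close>. At a point \<open>q \<noteq> O\<close> of \<open>L\<^sub>0\<close> the new value is
  \<open>m\<^sub>1 + m\<^sub>2\<close> minus the sum of the \<open>a\<^sub>j\<close> over the lines missing \<open>q\<close>. Writing \<open>m\<^sub>1\<close>, \<open>m\<^sub>2\<close> as
  sums over the lines through extremal points \<open>p\<^sub>1\<close>, \<open>p\<^sub>2\<close>, everything cancels up to nonpositive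
  terms except possibly one \<open>a\<^sub>j\<close>, coming from a line joining two of \<open>p\<^sub>1\<close>, \<open>p\<^sub>2\<close>, \<open>q\<close>; the
  conditions on \<open>q\<close> exclude that two such lines occur. So the real part is less than \<open>1\<close>.\<close>

section \<open>Points and lines of the projective plane\<close>

lemma proportional_vec:
  fixes x y :: "'a::field^'n"
  assumes "x \<noteq> 0" and eq: "\<And>i j. x $ i * y $ j = x $ j * y $ i"
  obtains t where "y = t *s x"
proof -
  obtain i where i: "x $ i \<noteq> 0"
    using \<open>x \<noteq> 0\<close> by (auto simp: vec_eq_iff)
  have "y $ j = y $ i / x $ i * x $ j" for j
    using i eq[of i j] by (simp add: field_simps)
  then have "y = (y $ i / x $ i) *s x"
    unfolding vec_eq_iff vector_smult_component by blast
  then show ?thesis by (rule that)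
qed

lemma Rep_cp2_span:
  obtains v where "v \<noteq> 0" "Rep_cp2 p = vec.span {v}"
  using Rep_cp2[of p] by auto

lemma zero_locus_scale:
  assumes "t \<noteq> 0"
  shows "zero_locus (t *s f) = zero_locus f"
proof -
  have "(\<Sum>i\<in>UNIV. (t *s f) $ i * v $ i) = t * (\<Sum>i\<in>UNIV. f $ i * v $ i)" for v
    by (simp add: sum_distrib_left mult.assoc)
  then show ?thesis
    using assms by (simp add: zero_locus_def)
qed

lemma span_singleton_scale:
  fixes x :: "'a::field^'n"
  assumes "t \<noteq> 0"
  shows "vec.span {t *s x} = vec.span {x}"
proof -
  have "t *s x \<in> vec.span {x}"
    by (simp add: vec.span_base vec.span_scale)
  moreover have "inverse t *s (t *s x) \<in> vec.span {t *s x}"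
    by (intro vec.span_scale vec.span_base) simp
  ultimately show ?thesis
    using assms by (simp add: vec.span_eq)
qed

text \<open>The cross product of the coefficient vectors of two lines spans their intersection, unless
  it vanishes and the coefficient vectors are proportional.\<close>

lemma distinct_lines_meet_once:
  assumes "is_line l" "is_line l'" "l \<noteq> l'"
    and "p \<in> l" "p \<in> l'" "q \<in> l" "q \<in> l'"
  shows "p = q"
proof -
  obtain f g where f: "f \<noteq> 0" "l = zero_locus f" and g: "g \<noteq> 0" "l' = zero_locus g"
    using assms unfolding is_line_def by blast
  define c :: "complex^3" where
    "c = vector [f$2 * g$3 - f$3 * g$2, f$3 * g$1 - f$1 * g$3, f$1 * g$2 - f$2 * g$1]"
  have c: "c$1 = f$2 * g$3 - f$3 * g$2" "c$2 = f$3 * g$1 - f$1 * g$3"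
    "c$3 = f$1 * g$2 - f$2 * g$1"
    by (simp_all add: c_def)
  have "c \<noteq> 0"
  proof
    assume "c = 0"
    then have "\<forall>i j. f $ i * g $ j = f $ j * g $ i"
      using c by (simp add: forall_3 mult.commute)
    then obtain t where t: "g = t *s f"
      using proportional_vec[OF f(1)] by blast
    with g(1) have "t \<noteq> 0" by auto
    then show False
      using assms(3) f(2) g(2) t zero_locus_scale by simp
  qed
  have "Rep_cp2 r = vec.span {c}" if r: "r \<in> l" "r \<in> l'" for r
  proof -
    obtain v where v: "v \<noteq> 0" "Rep_cp2 r = vec.span {v}"
      by (rule Rep_cp2_span)
    have "v \<in> Rep_cp2 r"
      using v(2) by (simp add: vec.span_base)
    with r f(2) g(2) have fv: "f$1 * v$1 + f$2 * v$2 + f$3 * v$3 = 0"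
      and gv: "g$1 * v$1 + g$2 * v$2 + g$3 * v$3 = 0"
      unfolding zero_locus_def by (auto simp: sum_3)
    have "c$1 * v$2 = c$2 * v$1" "c$1 * v$3 = c$3 * v$1" "c$2 * v$3 = c$3 * v$2"
    proof -
      let ?F = "f$1 * v$1 + f$2 * v$2 + f$3 * v$3" and ?G = "g$1 * v$1 + g$2 * v$2 + g$3 * v$3"
      \<comment> \<open>These are the coordinates of the double cross product (f x g) x v, hence
        combinations of the two line equations \<open>?F\<close> and \<open>?G\<close>.\<close>
      have "c$1 * v$2 - c$2 * v$1 = g$3 * ?F - f$3 * ?G" "c$1 * v$3 - c$3 * v$1 = f$2 * ?G - g$2 * ?F"
        "c$2 * v$3 - c$3 * v$2 = g$1 * ?F - f$1 * ?G"
        unfolding c by (simp_all add: algebra_simps)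
      then show "c$1 * v$2 = c$2 * v$1" "c$1 * v$3 = c$3 * v$1" "c$2 * v$3 = c$3 * v$2"
        unfolding fv gv by simp_all
    qed
    then have "\<forall>i j. c $ i * v $ j = c $ j * v $ i"
      by (simp add: forall_3)
    then obtain t where t: "v = t *s c"
      using proportional_vec[OF \<open>c \<noteq> 0\<close>] by blast
    with v(1) have "t \<noteq> 0" by auto
    with v(2) t show ?thesis
      by (simp add: span_singleton_scale)
  qed
  then show ?thesis
    using assms Rep_cp2_inject by metis
qed

lemma line_through_eqI:
  assumes "is_line l" "p \<in> l" "q \<in> l" "p \<noteq> q"
  shows "line_through p q = l"
  unfolding line_through_def
proof (rule the_equality)
  show "l' = l" if "is_line l' \<and> p \<in> l' \<and> q \<in> l'" for l'
    using assms that distinct_lines_meet_once[of l' l p q] by blast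
qed (use assms in blast)

lemma lines_through_two_points:
  assumes "line_arrangement n L" "p \<noteq> q"
  shows "card {j. j \<le> n \<and> p \<in> L j \<and> q \<in> L j} \<le> 1"
proof (rule card_le_Suc0_iff_eq[THEN iffD2, unfolded One_nat_def[symmetric]])
  show "\<forall>j\<in>{j. j \<le> n \<and> p \<in> L j \<and> q \<in> L j}. \<forall>k\<in>{j. j \<le> n \<and> p \<in> L j \<and> q \<in> L j}. j = k"
    using assms distinct_lines_meet_once
    unfolding line_arrangement_def inj_on_def by (metis (no_types, lifting) atMost_iff mem_Collect_eq)
qed simp

section \<open>Weights in [0,1) summed over sets of indices\<close>

lemma sum_less_one:
  fixes w :: "'a \<Rightarrow> real"
  assumes "card S \<le> 1" "\<And>j. j \<in> S \<Longrightarrow> w j < 1"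
  shows "sum w S < 1"
proof (cases "finite S")
  case True
  then show ?thesis
    using assms by (cases "card S = 0") (auto simp: le_Suc_eq card_1_singleton_iff)
qed simp

text \<open>Indices in both \<open>S\<close> and \<open>T\<close> are counted twice, and those of
  the union that lie in \<open>Q\<close> are paid for by \<open>sum w Q\<close>. What remains is the
  overlap and the part outside \<open>Q\<close>, together at most one index, of weight below
  1.\<close>

lemma sum_add_sum_less:
  fixes w :: "'a \<Rightarrow> real"
  assumes fin: "finite J" and sub: "S \<subseteq> J" "T \<subseteq> J" "Q \<subseteq> J"
    and w: "\<And>j. j \<in> J \<Longrightarrow> 0 \<le> w j \<and> w j < 1"
    and card: "card (S \<union> T - Q) + card (S \<inter> T) \<le> 1"
  shows "sum w S + sum w T < sum w Q + 1"
proof -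
  have finS: "finite S" "finite T" "finite Q"
    using fin sub by (auto intro: finite_subset)
  have "sum w S + sum w T = sum w (S \<union> T) + sum w (S \<inter> T)"
    using finS by (simp add: sum.union_inter)
  also have "sum w (S \<union> T) = sum w (S \<union> T - Q) + sum w ((S \<union> T) \<inter> Q)"
    using finS sum.Int_Diff[of "S \<union> T" w Q] by simp
  also have "sum w ((S \<union> T) \<inter> Q) \<le> sum w Q"
    using finS sub w by (intro sum_mono2) auto
  finally have le: "sum w S + sum w T \<le> sum w (S \<union> T - Q) + sum w Q + sum w (S \<inter> T)"
    by simp
  have lt: "sum w (S \<union> T - Q) < 1" "sum w (S \<inter> T) < 1"
    using card w sub by (auto intro!: sum_less_one)
  consider "S \<union> T - Q = {}" | "S \<inter> T = {}"
  proof -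
    have "card (S \<union> T - Q) = 0 \<or> card (S \<inter> T) = 0"
      using card by arith
    with finS that show ?thesis
      by (metis card_0_eq finite_Diff finite_Int finite_UnI)
  qed
  then show ?thesis
  proof cases
    case 1
    with le lt show ?thesis by (simp only: sum.empty)
  next
    case 2
    with le lt show ?thesis by (simp only: sum.empty)
  qed
qed

section \<open>Maximal values and extremal points\<close>

lemma finite_range_b_value: "finite (range (b_value n L a))"
proof (rule finite_subset)
  \<comment> \<open>A value depends only on which lines contain the point, so finitely many occur
    and \<open>Max\<close> is meaningful.\<close>
  show "range (b_value n L a) \<subseteq> (\<lambda>S. Re (sum a S)) ` Pow {..n}"
    by (auto simp: b_value_def residue_at_def)
qed simp

lemma le_max_b:
  assumes "p \<in> multiple_points (L ` {..n})" "p \<in> L j" "p \<noteq> pO" "b_value n L a p \<in> pos_ints"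
  shows "b_value n L a p \<le> max_b n L a pO j"
proof -
  have "finite (b_value n L a ` B)" for B
    using finite_range_b_value by (rule finite_subset[rotated]) auto
  with assms show ?thesis
    unfolding max_b_def Let_def by (auto intro!: Max_ge)
qed

text \<open>A maximum over a nonempty set is a positive integer attained at some point, so 0 arises
  only as the default value.\<close>

lemma max_b_cases:
  obtains "max_b n L a pO j = 0" "extremal_points n L a pO j = {}"
  | p where "max_b n L a pO j \<in> pos_ints" "p \<in> extremal_points n L a pO j"
proof (cases "max_b n L a pO j = 0")
  case True
  then show ?thesis
    by (intro that(1)) (auto simp: extremal_points_def)
next
  case False
  define B where "B = {p \<in> multiple_points (L ` {..n}) \<inter> L j. p \<noteq> pO \<and> b_value n L a p \<in> pos_ints}"
  have "B \<noteq> {}" and m: "max_b n L a pO j = Max (b_value n L a ` B)"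
    using False unfolding max_b_def B_def Let_def by (auto split: if_splits)
  moreover have "finite (b_value n L a ` B)"
    using finite_range_b_value by (rule finite_subset[rotated]) auto
  ultimately have "max_b n L a pO j \<in> b_value n L a ` B"
    using Max_in by simp
  then obtain p where p: "p \<in> B" "max_b n L a pO j = b_value n L a p"
    by blast
  then have "max_b n L a pO j \<in> pos_ints"
    by (simp add: B_def)
  moreover from this have "max_b n L a pO j > 0"
    by (auto simp: pos_ints_def)
  with p have "p \<in> extremal_points n L a pO j"
    by (simp add: extremal_points_def B_def)
  ultimately show ?thesis by (rule that(2))
qed

section \<open>Integer shifts and normalized residues\<close>

lemma Re_pos_ints: "z \<in> pos_ints \<Longrightarrow> Re z \<in> pos_ints"
  by (auto simp: pos_ints_def)

lemma pos_ints_ge_1: "(x::real) \<in> pos_ints \<Longrightarrow> 1 \<le> x"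
  by (auto simp: pos_ints_def)

lemma exp_class_add_int: "exp_class (\<lambda>j. a j + of_int (c j)) j = exp_class a j"
proof -
  have "exp (2 * of_real pi * \<i> * of_int k) = 1" for k :: int
    using exp_integer_2pi[of "of_int k"] by (simp add: mult_ac)
  then show ?thesis
    by (simp add: exp_class_def ring_distribs exp_add)
qed

lemma H1_class_normalized:
  assumes "normalized_residues n lam a"
  shows "H1_class n a"
proof -
  have "{..n} = insert 0 {1..n}" by auto
  then show ?thesis
    using assms by (simp add: H1_class_def normalized_residues_def)
qed

text \<open>Both families have product 1, so agreement at all indices from 1 on forces agreement at
  0.\<close>

lemma exp_class_normalized:
  assumes loc: "rank_one_local_system n lam" and res: "normalized_residues n lam a" and "j \<le> n"
  shows "exp_class a j = lam j"
proof (cases "j = 0")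
  case True
  have split: "{..n} = insert 0 {1..n}" by auto
  have "(\<Prod>j\<le>n. exp_class a j) = exp (2 * of_real pi * \<i> * (\<Sum>j\<le>n. a j))"
    by (simp add: exp_class_def exp_sum sum_distrib_left)
  also have "\<dots> = (\<Prod>j\<le>n. lam j)"
    using H1_class_normalized[OF res] loc by (simp add: H1_class_def rank_one_local_system_def)
  finally have "exp_class a 0 * (\<Prod>j=1..n. exp_class a j) = lam 0 * (\<Prod>j=1..n. lam j)"
    by (simp add: split)
  moreover have "(\<Prod>j=1..n. exp_class a j) = (\<Prod>j=1..n. lam j)"
    using res by (intro prod.cong) (auto simp: normalized_residues_def)
  moreover have "(\<Prod>j=1..n. lam j) \<noteq> 0"
    using loc by (auto simp: rank_one_local_system_def)
  ultimately show ?thesis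
    using True by simp
next
  case False
  then show ?thesis
    using res \<open>j \<le> n\<close> by (simp add: normalized_residues_def)
qed

text \<open>The residues sum to 0, so those of the lines through \<open>q\<close> can be traded for
  those of the lines missing \<open>q\<close>, which avoid \<open>L 0\<close> and have real parts in
  [0,1).\<close>

lemma b_value_on_L0:
  assumes "normalized_residues n lam a" "q \<in> L 0"
  shows "b_value n L a q = - (\<Sum>j | j \<in> {1..n} \<and> q \<notin> L j. Re (a j))"
proof -
  have "{j. j \<le> n \<and> q \<in> L j} = insert 0 {j \<in> {1..n}. q \<in> L j}"
    using assms(2) by auto
  moreover have "finite {j \<in> {1..n}. q \<in> L j}"
    by (rule finite_subset[of _ "{1..n}"]) auto
  ultimately have "residue_at n L a q = a 0 + (\<Sum>j | j \<in> {1..n} \<and> q \<in> L j. a j)"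
    by (simp add: residue_at_def)
  also have "a 0 = - (\<Sum>j=1..n. a j)"
    using assms(1) by (simp add: normalized_residues_def)
  also have "(\<Sum>j=1..n. a j) = (\<Sum>j | j \<in> {1..n} \<and> q \<in> L j. a j) + (\<Sum>j | j \<in> {1..n} \<and> q \<notin> L j. a j)"
    using sum.Int_Diff[of "{1..n}" a "{j. q \<in> L j}"]
    by (simp add: Int_def set_diff_eq)
  finally show ?thesis
    by (simp add: b_value_def)
qed

lemma b_value_off_L0:
  assumes "q \<notin> L 0"
  shows "b_value n L a q = (\<Sum>j | j \<in> {1..n} \<and> q \<in> L j. Re (a j))"
proof -
  have "{j. j \<le> n \<and> q \<in> L j} = {j \<in> {1..n}. q \<in> L j}"
    using assms by (auto simp: Suc_le_eq intro: gr0I)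
  then show ?thesis
    by (simp add: b_value_def residue_at_def)
qed

theorem proposition3p1:
  fixes n :: nat and L :: "nat \<Rightarrow> cp2 set" and pO :: cp2
    and lam a :: "nat \<Rightarrow> complex"
  defines "A \<equiv> L ` {..n}"
    and "P \<equiv> extremal_points n L a pO"
    and "Y \<equiv> lines_through_union (L ` {..n})"
  assumes arr: "line_arrangement n L" and n2: "n \<ge> 2"
    and C3: "in_class_C 3 A"
    and cover: "multiple_points A \<subseteq> L 0 \<union> L 1 \<union> L 2"
    and conc: "L 0 \<inter> L 1 \<inter> L 2 = {pO}"
    and loc: "rank_one_local_system n lam"
    and res: "normalized_residues n lam a"
    and cond: "P 1 = {} \<or> P 2 = {} \<or>
      (\<forall>q \<in> L 0. q \<noteq> pO \<and> multiplicity_at A q \<ge> 3 \<longrightarrow>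
         (P 1 - Y q \<noteq> {} \<and> P 2 - Y q \<noteq> {}) \<or>
         (\<exists>(i, j) \<in> {(1, 2), (2, 1)}.
            \<exists>p\<^sub>i \<in> P i - Y q. \<exists>p\<^sub>j \<in> P j. line_through p\<^sub>i p\<^sub>j \<notin> A))"
  shows "admissible n L lam"
proof -
  \<comment> \<open>Keeps the index 1 in \<open>L 1\<close>, \<open>P 1\<close>, \<open>m 1\<close>
    from becoming \<open>Suc 0\<close>.\<close>
  note One_nat_def [simp del]
  define m where "m = max_b n L a pO"
  define w where "w j = Re (a j)" for j
  define I where "I p = {j \<in> {1..n}. p \<in> L j}" for p
  define N where "N q = {j \<in> {1..n}. q \<notin> L j}" for q
  have lines: "is_line (L j)" if "j \<le> n" for j
    using arr that by (simp add: line_arrangement_def)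
  have w: "0 \<le> w j \<and> w j < 1" if "j \<in> {1..n}" for j
    using res that by (simp add: normalized_residues_def w_def)
  have meet_O: "p = pO" if "i \<le> 2" "j \<le> 2" "i \<noteq> j" "p \<in> L i" "p \<in> L j" for i j p
  proof (rule distinct_lines_meet_once)
    show "is_line (L i)" "is_line (L j)"
      using lines n2 that by simp_all
    show "L i \<noteq> L j"
      using arr n2 that unfolding line_arrangement_def inj_on_def by auto
    have "i \<in> {0, 1, 2}" "j \<in> {0, 1, 2}"
      using that by auto
    then show "pO \<in> L i" "pO \<in> L j"
      using conc by auto
  qed (use that in simp_all)
  have O_in: "pO \<in> L 0" "pO \<in> L 1" "pO \<in> L 2"
    using conc by auto
  \<comment> \<open>\<open>L i\<close> meets \<open>L 0\<close> only in O, so an extremal point lies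
    off \<open>L 0\<close> and its value involves only the weights of the other lines.\<close>
  have ext: "m i = sum w (I p)" "p \<in> L i" "p \<noteq> pO" "p \<notin> L 0"
    if "p \<in> P i" "i \<in> {1, 2}" for p i
  proof -
    show *: "p \<in> L i" "p \<noteq> pO"
      using that by (auto simp: P_def extremal_points_def split: if_splits)
    then show "p \<notin> L 0"
      using meet_O[of 0 i p] that by auto
    then show "m i = sum w (I p)"
      using b_value_off_L0[of p L n a] that
      by (auto simp: P_def extremal_points_def m_def I_def w_def split: if_splits)
  qed
  have ex_k: "\<exists>k::int. m i = of_int k" for i
    by (rule max_b_cases[of n L a pO i]) (auto simp: m_def pos_ints_def intro: exI[of _ 0])
  obtain k1 k2 :: int where k: "m 1 = of_int k1" "m 2 = of_int k2"
    using ex_k by meson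
  have m_empty: "m i = 0" if "P i = {}" for i
    using that by (cases rule: max_b_cases[of n L a pO i]) (auto simp: m_def P_def)
  have card_I: "card (I p \<inter> I q) \<le> 1" if "p \<noteq> q" for p q
  proof -
    have "card (I p \<inter> I q) \<le> card {j. j \<le> n \<and> p \<in> L j \<and> q \<in> L j}"
      by (rule card_mono) (auto simp: I_def)
    also have "\<dots> \<le> 1"
      by (rule lines_through_two_points[OF arr that])
    finally show ?thesis .
  qed
  have diff_N: "I p - N q = I p \<inter> I q" for p q
    by (auto simp: I_def N_def)
  \<comment> \<open>For \<open>S\<close> and \<open>T\<close> of the form \<open>I p\<close>, the
    first cardinality counts the lines joining extremal points to \<open>q\<close> (by
    \<open>diff_N\<close>), the second those joining the two extremal points to each other.\<close>
  have less_N: "m 1 + m 2 < sum w (N q) + 1"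
    if "S \<subseteq> {1..n}" "T \<subseteq> {1..n}" "m 1 = sum w S" "m 2 = sum w T"
      "card (S \<union> T - N q) + card (S \<inter> T) \<le> 1" for S T q
    unfolding that(3,4)
    by (rule sum_add_sum_less[of "{1..n}"]) (use that w in \<open>auto simp: N_def\<close>)
  have I_sub: "I p \<subseteq> {1..n}" for p
    by (auto simp: I_def)
  have P12_ne: "p1 \<noteq> p2" if "p1 \<in> P 1" "p2 \<in> P 2" for p1 p2
    using ext[OF that(1)] ext[OF that(2)] meet_O[of 1 2 p1] by auto
  have L0_bound: "m 1 + m 2 < sum w (N q) + 1"
    if q: "q \<in> L 0" "q \<noteq> pO" "multiplicity_at A q \<ge> 3" for q
  proof -
    have disj_Y: "I p \<inter> I q = {}" if "p \<notin> Y q" for p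
      using that by (auto simp: I_def Y_def lines_through_union_def)
    have disj_line: "I p1 \<inter> I p2 = {}"
      if p: "p1 \<in> P 1" "p2 \<in> P 2" "line_through p1 p2 \<notin> A \<or> line_through p2 p1 \<notin> A" for p1 p2
    proof (rule ccontr)
      assume "I p1 \<inter> I p2 \<noteq> {}"
      then obtain j where j: "j \<le> n" "p1 \<in> L j" "p2 \<in> L j"
        by (auto simp: I_def)
      then have "line_through p1 p2 = L j" "line_through p2 p1 = L j"
        using lines P12_ne[OF p(1,2)] by - ((rule line_through_eqI; simp)+)
      with j p(3) show False
        by (simp add: A_def)
    qed
    have ne_q: "p \<noteq> q" if "p \<in> P i" "i \<in> {1, 2}" for p i
      using ext(4)[OF that] q(1) by auto
    \<comment> \<open>The last case merges the two orders of (i,j) in condition (b).\<close>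
    consider "P 1 = {}" | "P 2 = {}" | p1 p2 where "p1 \<in> P 1" "p2 \<in> P 2" "p1 \<notin> Y q" "p2 \<notin> Y q"
      | p1 p2 where "p1 \<in> P 1" "p2 \<in> P 2" "p1 \<notin> Y q \<or> p2 \<notin> Y q"
        "line_through p1 p2 \<notin> A \<or> line_through p2 p1 \<notin> A"
    proof -
      have "P 1 = {} \<or> P 2 = {} \<or> (P 1 - Y q \<noteq> {} \<and> P 2 - Y q \<noteq> {}) \<or>
          (\<exists>p1\<in>P 1 - Y q. \<exists>p2\<in>P 2. line_through p1 p2 \<notin> A) \<or>
          (\<exists>p2\<in>P 2 - Y q. \<exists>p1\<in>P 1. line_through p2 p1 \<notin> A)"
        using cond
      proof (elim disjE)
        assume "\<forall>q\<in>L 0. q \<noteq> pO \<and> multiplicity_at A q \<ge> 3 \<longrightarrow>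
         (P 1 - Y q \<noteq> {} \<and> P 2 - Y q \<noteq> {}) \<or>
         (\<exists>(i, j) \<in> {(1, 2), (2, 1)}.
            \<exists>p\<^sub>i \<in> P i - Y q. \<exists>p\<^sub>j \<in> P j. line_through p\<^sub>i p\<^sub>j \<notin> A)"
        from bspec[OF this q(1)] q(2,3) show ?thesis by simp
      qed simp_all
      then show ?thesis
        using that by blast
    qed
    then show ?thesis
    proof cases
      case 1
      show ?thesis
      proof (cases "P 2 = {}")
        case True
        show ?thesis
          by (rule less_N[of "{}" "{}"]) (simp_all add: m_empty 1 True)
      next
        case False
        then obtain p where p: "p \<in> P 2" by blast
        show ?thesis
          by (rule less_N[of "{}" "I p"])
            (use 1 p ext ne_q card_I I_sub in \<open>simp_all add: m_empty diff_N\<close>)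
      qed
    next
      case 2
      show ?thesis
      proof (cases "P 1 = {}")
        case True
        show ?thesis
          by (rule less_N[of "{}" "{}"]) (simp_all add: m_empty 2 True)
      next
        case False
        then obtain p where p: "p \<in> P 1" by blast
        show ?thesis
          by (rule less_N[of "I p" "{}"])
            (use 2 p ext ne_q card_I I_sub in \<open>simp_all add: m_empty diff_N\<close>)
      qed
    next
      \<comment> \<open>Neither extremal point is joined to \<open>q\<close>; only the line joining
        them to each other can count.\<close>
      case 3
      then have "I p1 \<union> I p2 - N q = {}"
        using disj_Y diff_N by blast
      then have "card (I p1 \<union> I p2 - N q) + card (I p1 \<inter> I p2) \<le> 1"
        using card_I[OF P12_ne[OF 3(1,2)]] by (simp only: card.empty add_0_left)
      then show ?thesis
        using 3 ext I_sub by (intro less_N[of "I p1" "I p2"]) simp_all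
    next
      \<comment> \<open>The extremal points are not joined to each other and at most one of them is
        joined to \<open>q\<close>, by a single line.\<close>
      case 4
      have inter: "I p1 \<inter> I p2 = {}"
        using disj_line 4 by blast
      have "I p1 \<union> I p2 - N q = I p1 \<inter> I q \<or> I p1 \<union> I p2 - N q = I p2 \<inter> I q"
        using 4(3) disj_Y[of p1] disj_Y[of p2] diff_N[of p1 q] diff_N[of p2 q] by blast
      then have "card (I p1 \<union> I p2 - N q) \<le> 1"
        using card_I ne_q[of p1 1] ne_q[of p2 2] 4 by auto
      with inter show ?thesis
        using 4 ext I_sub by (intro less_N[of "I p1" "I p2"]) simp_all
    qed
  qed
  \<comment> \<open>If \<open>P i\<close> is empty, the default value 0 of \<open>m i\<close> is the
    empty sum, so both situations take the same form.\<close>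
  have ex_S: "\<exists>S\<subseteq>{1..n}. m i = sum w S \<and> (P i = {} \<and> S = {} \<or> (\<exists>p\<in>P i. S = I p))"
    if "i \<in> {1, 2}" for i
  proof (cases "P i = {}")
    case True
    then show ?thesis
      using m_empty[of i] by (intro exI[of _ "{}"]) simp
  next
    case False
    then obtain p where "p \<in> P i" by blast
    then show ?thesis
      using ext(1)[OF _ that] I_sub by (intro exI[of _ "I p"]) blast
  qed
  \<comment> \<open>The same estimate with all of \<open>{1..n}\<close> in place of
    \<open>N q\<close>: only the overlap remains, at most the line joining two extremal
    points.\<close>
  have a0_bound: "m 1 + m 2 < sum w {1..n} + 1"
  proof -
    obtain S T where ST: "S \<subseteq> {1..n}" "T \<subseteq> {1..n}" "m 1 = sum w S" "m 2 = sum w T"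
      and S: "P 1 = {} \<and> S = {} \<or> (\<exists>p\<in>P 1. S = I p)"
      and T: "P 2 = {} \<and> T = {} \<or> (\<exists>p\<in>P 2. T = I p)"
      using ex_S[of 1] ex_S[of 2] by blast
    from S T have "card (S \<inter> T) \<le> 1"
      using card_I P12_ne by force
    then have "card (S \<union> T - {1..n}) + card (S \<inter> T) \<le> 1"
      using ST(1,2) by (simp add: Diff_eq_empty_iff[THEN iffD2])
    with ST w show ?thesis
      unfolding ST(3,4) by (intro sum_add_sum_less[of "{1..n}"]) auto
  qed
  \<comment> \<open>Written as a sum of three one-point functions, so that \<open>sum.delta\<close>
    evaluates it over any set of lines; the total is 0.\<close>
  define c :: "nat \<Rightarrow> int" where
    "c j = (if j = 0 then k1 + k2 else 0) + (if j = 1 then - k1 else 0) + (if j = 2 then - k2 else 0)" for j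
  define a' where "a' j = a j + of_int (c j)" for j
  have sum_c: "(\<Sum>j | j \<le> n \<and> R j. c j) =
      (if R 0 then k1 + k2 else 0) + (if R 1 then - k1 else 0) + (if R 2 then - k2 else 0)" for R
    using n2 by (simp add: c_def sum.distrib sum.delta del: One_nat_def)
  have b': "b_value n L a' p = b_value n L a p +
      (if p \<in> L 0 then m 1 + m 2 else 0) - (if p \<in> L 1 then m 1 else 0) - (if p \<in> L 2 then m 2 else 0)" for p
  proof -
    have "residue_at n L a' p = residue_at n L a p + of_int (\<Sum>j | j \<le> n \<and> p \<in> L j. c j)"
      by (simp add: residue_at_def a'_def sum.distrib)
    then show ?thesis
      unfolding sum_c b_value_def by (simp add: k)
  qed
  have "H1_class n a'"
    using H1_class_normalized[OF res] sum_c[of "\<lambda>_. True"]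
    by (simp add: H1_class_def a'_def sum.distrib atMost_def flip: of_int_sum)
  moreover have "exp_class a' j = lam j" if "j \<le> n" for j
    using exp_class_normalized[OF loc res that] exp_class_add_int[of a c j] by (simp add: a'_def[abs_def])
  moreover have "a' j \<notin> pos_ints" if "j \<le> n" for j
  proof -
    \<comment> \<open>At indices from 1 on, the shift subtracts a nonnegative number or nothing, so
      real parts stay below 1.\<close>
    have m_ge: "0 \<le> m i" for i
      by (rule max_b_cases[of n L a pO i]) (auto simp: m_def pos_ints_def)
    have "Re (a' j) < 1"
    proof (cases "j = 0")
      case True
      have "Re (a 0) = - sum w {1..n}"
        using res by (simp add: normalized_residues_def w_def)
      then show ?thesis
        using a0_bound True k by (simp add: a'_def c_def)
    next
      case False
      then show ?thesis
        using w[of j] that m_ge[of 1] m_ge[of 2] k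
        by (cases "j = 1"; cases "j = 2") (auto simp: a'_def c_def w_def)
    qed
    then show ?thesis
      using Re_pos_ints pos_ints_ge_1 by fastforce
  qed
  moreover have "residue_at n L a' p \<notin> pos_ints" if p: "multiplicity_at A p \<ge> 3" for p
  proof
    assume "residue_at n L a' p \<in> pos_ints"
    then have b'_pos: "b_value n L a' p \<in> pos_ints"
      unfolding b_value_def by (rule Re_pos_ints)
    have mult: "p \<in> multiple_points (L ` {..n})"
      using p by (simp add: multiple_points_def A_def)
    \<comment> \<open>Undoing the shift adds the nonnegative integer \<open>m i\<close>, so the old
      value would be a positive integer exceeding the maximum \<open>m i\<close>.\<close>
    have side: False if i: "i \<in> {1, 2}" "p \<in> L i" "p \<noteq> pO" for i
    proof -
      have *: "b_value n L a' p = b_value n L a p - m i"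
        using i meet_O[of 0 i p] meet_O[of 1 2 p] by (auto simp: b')
      obtain k :: int where k: "m i = of_int k" "0 \<le> k"
        by (rule max_b_cases[of n L a pO i]) (auto simp: m_def pos_ints_def)
      obtain r :: int where r: "r > 0" "b_value n L a' p = of_int r"
        using b'_pos by (auto simp: pos_ints_def)
      have "b_value n L a p = of_int (r + k)"
        using * k r by simp
      then have "b_value n L a p \<in> pos_ints"
        unfolding pos_ints_def using k r by (intro image_eqI[of _ _ "r + k"]) simp_all
      then have "b_value n L a p \<le> m i"
        unfolding m_def using mult i by (intro le_max_b)
      with * r show False by simp
    qed
    consider "p = pO" | "p \<noteq> pO" "p \<in> L 0" | i where "i \<in> {1, 2}" "p \<noteq> pO" "p \<in> L i"
      using cover mult by (auto simp: A_def)
    then show False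
    proof cases
      \<comment> \<open>All three shifted lines pass through O, so the shifts cancel and the old
        nonpositive value remains.\<close>
      case 1
      then have "b_value n L a' p = - sum w (N p)"
        using b_value_on_L0[OF res, of p L] O_in by (simp add: b' N_def w_def)
      moreover have "0 \<le> sum w (N p)"
        using w by (intro sum_nonneg) (auto simp: N_def)
      ultimately show False
        using pos_ints_ge_1[OF b'_pos] by simp
    next
      \<comment> \<open>\<open>L 1\<close> and \<open>L 2\<close> miss \<open>p\<close>, so both
        maxima are added in full and \<open>L0_bound\<close> is what keeps the value below
        1.\<close>
      case 2
      then have "b_value n L a' p = - sum w (N p) + m 1 + m 2"
        using b_value_on_L0[OF res, of p L] meet_O[of 0 1 p] meet_O[of 0 2 p]
        by (auto simp: b' N_def w_def)
      then show False
        using pos_ints_ge_1[OF b'_pos] L0_bound[of p] 2 p by simp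
    next
      case 3
      then show False using side by blast
    qed
  qed
  ultimately show ?thesis
    unfolding admissible_def A_def by blast
qed

end
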